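(* Let $D$ be a $7$-anti-transitive oriented graph on $n$ vertices. If the minimum out-degree and the minimum in-degree of $D$ are both at least $\frac{n}{3}$, then $D$ has a directed triangle, i.e. there are vertices $x,y,z$ of $D$ with $(x,y),(y,z),(z,x)\in E(D)$.
   Context: A digraph $D=(V,E)$ has a non-empty vertex set $V=V(D)$ and arc set $E=E(D)\subseteq V\times V$. An oriented graph is a finite digraph with no loops ($(u,u)\notin E$) and with at most one arc between any two vertices (so $(u,v)$ and $(v,u)$ are never both in $E$). The out-degree (in-degree) of a vertex $v$ is the number of vertices $u$ with $(v,u)\in E$ (respectively $(u,v)\in E$). Directed paths have pairwise distinct vertices, and the length of a directed path is its number of arcs. A digraph $D$ is $k$-anti-transitive if for every pair of vertices $u,v\in V(D)$, the existence of a directed path of length $k$ from $u$ to $v$ implies $(u,v)\notin E(D)$. *)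

theory Defs
  imports Complex_Main "Graph_Theory.Pair_Digraph"
begin

text \<open>
  Arcs are pairs of vertices, so an arc set cannot contain parallel arcs. The locale
  \<^locale>\<open>pair_digraph\<close> requires finiteness, arcs between vertices only and no loops, but it
  allows the null graph and pairs of opposite arcs.
\<close>

locale oriented_graph = pair_digraph D for D :: "'a pair_pre_digraph" +
  assumes verts_nonempty: "pverts D \<noteq> {}"
    and no_opposite_arcs: "(u, v) \<in> parcs D \<Longrightarrow> (v, u) \<notin> parcs D"

text \<open>
  An \<open>apath\<close> is given by its list of arcs, so \<^term>\<open>length p\<close> is the length of the path;
  its vertices, both ends included, are pairwise distinct.
\<close>

definition anti_transitive :: "nat \<Rightarrow> 'a pair_pre_digraph \<Rightarrow> bool" where
  "anti_transitive k D \<longleftrightarrow>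
    (\<forall>u \<in> pverts D. \<forall>v \<in> pverts D.
      (\<exists>p. pre_digraph.apath (with_proj D) u p v \<and> length p = k) \<longrightarrow> (u, v) \<notin> parcs D)"

text \<open>Only meaningful for finite non-empty vertex sets, as in an oriented graph.\<close>

definition min_out_degree :: "'a pair_pre_digraph \<Rightarrow> nat" where
  "min_out_degree D = Min (out_degree (with_proj D) ` pverts D)"

definition min_in_degree :: "'a pair_pre_digraph \<Rightarrow> nat" where
  "min_in_degree D = Min (in_degree (with_proj D) ` pverts D)"

end

theory Submission
  imports Defs
begin

text \<open>
  Suppose that there is no directed triangle. For an arc $(v,w)$ the sets $N^-(v)$, $N^+(v)$,
  $N^+(w)$ and $\{v\}$ cannot be pairwise disjoint, as their sizes add up to more than $n$; the
  only pair that can meet is $N^+(v)$, $N^+(w)$. So every vertex of $N^+(v)$ has a successor in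
  $N^+(v)$, and dually every vertex of $N^-(v)$ has a predecessor in $N^-(v)$. Long paths inside
  neighbourhoods are then easily built, and some arc is bypassed by a path of length 7.
\<close>

text \<open>Four candidate paths are tried. Each of the first three can fail in only one way, a
  coincidence of two particular vertices, and that coincidence supplies a new arc. With these arcs
  the fourth cannot fail.\<close>

lemma bypass_of_length_7:
  fixes E :: "'a \<Rightarrow> 'a \<Rightarrow> bool"
  assumes arc: "E a b"
    and asym: "\<And>x y. E x y \<Longrightarrow> \<not> E y x"
    and no_triangle: "\<And>x y z. E x y \<Longrightarrow> E y z \<Longrightarrow> \<not> E z x"
    and out_ext: "\<And>v w. E v w \<Longrightarrow> \<exists>x. E v x \<and> E w x"
    and in_ext: "\<And>v w. E w v \<Longrightarrow> \<exists>x. E x v \<and> E x w"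
  shows "\<exists>x0 x1 x2 x3 x4 x5 x6 x7. distinct [x0, x1, x2, x3, x4, x5, x6, x7] \<and>
    E x0 x1 \<and> E x1 x2 \<and> E x2 x3 \<and> E x3 x4 \<and> E x4 x5 \<and> E x5 x6 \<and> E x6 x7 \<and> E x0 x7"
proof (rule ccontr)
  assume neg: "\<not> ?thesis"
  have no_bypass: False
    if "distinct [x0, x1, x2, x3, x4, x5, x6, x7]"
      "E x0 x1" "E x1 x2" "E x2 x3" "E x3 x4" "E x4 x5" "E x5 x6" "E x6 x7" "E x0 x7"
    for x0 x1 x2 x3 x4 x5 x6 x7
    using neg that by blast
  \<comment> \<open>The ends of a directed walk with one, two or three arcs differ, since closed
    walks of these lengths are excluded. Below, \<open>metis\<close> separates every pair of
    vertices by such a walk, except the one pair assumed distinct.\<close>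
  have apart1: "x \<noteq> y" "y \<noteq> x" if "E x y" for x y
    using that asym by blast+
  have apart2: "x \<noteq> z" "z \<noteq> x" if "E x y" "E y z" for x y z
    using that asym by blast+
  have apart3: "x \<noteq> w" "w \<noteq> x" if "E x y" "E y z" "E z w" for x y z w
    using that no_triangle by blast+
  note apart = apart1 apart2 apart3

  \<comment> \<open>The walk \<open>b\<close>, \<open>c2\<close>, \<open>c3\<close>,
    \<open>c4\<close>, \<open>c5\<close> stays inside the out-neighbourhood of
    \<open>a\<close>.\<close>
  obtain c2 where c2: "E a c2" "E b c2" using out_ext[OF arc] by blast
  obtain c3 where c3: "E a c3" "E c2 c3" using out_ext[OF c2(1)] by blast
  obtain c4 where c4: "E a c4" "E c3 c4" using out_ext[OF c3(1)] by blast
  obtain c5 where c5: "E a c5" "E c4 c5" using out_ext[OF c4(1)] by blast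
  have "c5 = b"
  proof (rule ccontr)
    assume "c5 \<noteq> b"
    obtain v1 where v1: "E v1 c5" "E v1 a" using in_ext[OF c5(1)] by blast
    obtain v2 where v2: "E v2 c5" "E v2 v1" using in_ext[OF v1(1)] by blast
    have "distinct [v2, v1, a, b, c2, c3, c4, c5]"
      by (simp, intro conjI; use \<open>c5 \<noteq> b\<close> arc c2 c3 c4 c5 v1 v2 in \<open>metis apart\<close>)
    then show False
      using no_bypass arc c2 c3 c4 c5 v1 v2 by blast
  qed
  \<comment> \<open>Now \<open>b\<close>, \<open>c2\<close>, \<open>c3\<close>, \<open>c4\<close>
    form a directed 4-cycle of out-neighbours of \<open>a\<close>.\<close>
  with c5 have c4b: "E c4 b" by simp

  \<comment> \<open>This walk runs backwards from \<open>a\<close> inside the in-neighbourhood of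
    \<open>c4\<close>. The arc from \<open>c4\<close> to \<open>b\<close> keeps \<open>v3\<close>
    away from \<open>b\<close> and \<open>c2\<close>, so only \<open>c3\<close> is left.\<close>
  obtain v1 where v1: "E v1 c4" "E v1 a" using in_ext[OF c4(1)] by blast
  obtain v2 where v2: "E v2 c4" "E v2 v1" using in_ext[OF v1(1)] by blast
  obtain v3 where v3: "E v3 c4" "E v3 v2" using in_ext[OF v2(1)] by blast
  have "v3 = c3"
  proof (rule ccontr)
    assume "v3 \<noteq> c3"
    have "distinct [v3, v2, v1, a, b, c2, c3, c4]"
      by (simp, intro conjI; use \<open>v3 \<noteq> c3\<close> arc c2 c3 c4 c4b v1 v2 v3 in \<open>metis apart\<close>)
    then show False
      using no_bypass arc c2 c3 c4 v1 v2 v3 by blast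
  qed
  with v3 have c3v2: "E c3 v2" by simp

  \<comment> \<open>From \<open>c4\<close> the walk continues inside the out-neighbourhood of
    \<open>v1\<close>. The new arc from \<open>c3\<close> to \<open>v2\<close> allows the detour
    \<open>a\<close>, \<open>c3\<close>, \<open>v2\<close>, \<open>c4\<close>.\<close>
  obtain w1 where w1: "E v1 w1" "E c4 w1" using out_ext[OF v1(1)] by blast
  obtain w2 where w2: "E v1 w2" "E w1 w2" using out_ext[OF w1(1)] by blast
  obtain w3 where w3: "E v1 w3" "E w2 w3" using out_ext[OF w2(1)] by blast
  have "w3 = a"
  proof (rule ccontr)
    assume "w3 \<noteq> a"
    have "distinct [v1, a, c3, v2, c4, w1, w2, w3]"
      by (simp, intro conjI; use \<open>w3 \<noteq> a\<close> c3 c4 v1 v2 c3v2 w1 w2 w3 in \<open>metis apart\<close>)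
    then show False
      using no_bypass c3 c4 v1 v2 c3v2 w1 w2 w3 by blast
  qed
  with w3 have w2a: "E w2 a" by simp

  \<comment> \<open>The arc from \<open>w2\<close> to \<open>a\<close> gives walks of at most three
    arcs from \<open>w1\<close> and \<open>w2\<close> to all out-neighbours of \<open>a\<close>, so
    nothing can coincide.\<close>
  have "distinct [v1, a, b, c2, c3, c4, w1, w2]"
    by (simp, intro conjI; use arc c2 c3 c4 c4b v1 w1 w2 w2a in \<open>metis apart\<close>)
  then show False
    using no_bypass arc c2 c3 c4 v1 w1 w2 by blast
qed

context pair_digraph
begin

lemma out_degree_eq_card: "out_degree (with_proj G) v = card {w. (v, w) \<in> parcs G}"
proof -
  have "out_arcs (with_proj G) v = Pair v ` {w. (v, w) \<in> parcs G}"
    by (auto simp: out_arcs_def)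
  then show ?thesis
    by (simp add: out_degree_def card_image inj_on_def)
qed

lemma in_degree_eq_card: "in_degree (with_proj G) v = card {u. (u, v) \<in> parcs G}"
proof -
  have "in_arcs (with_proj G) v = (\<lambda>u. (u, v)) ` {u. (u, v) \<in> parcs G}"
    by (auto simp: in_arcs_def)
  then show ?thesis
    by (simp add: in_degree_def card_image inj_on_def)
qed

end

text \<open>The vertex \<open>v\<close> outside the three sets makes the inequality strict, which is
  what contradicts three sizes of at least a third of \<open>card V\<close>.\<close>

lemma card_three_disjoint_subsets_less:
  assumes "finite V" "A \<subseteq> V" "B \<subseteq> V" "C \<subseteq> V" "v \<in> V" "v \<notin> A" "v \<notin> B" "v \<notin> C"
    and "A \<inter> B = {}" "A \<inter> C = {}" "B \<inter> C = {}"
  shows "card A + card B + card C < card V"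
proof -
  have fin: "finite A" "finite B" "finite C"
    using assms finite_subset by blast+
  have "card A + card B + card C = card (A \<union> B \<union> C)"
    using fin assms by (simp add: card_Un_disjoint Int_Un_distrib2)
  also have "\<dots> < card V"
    using assms by (intro psubset_card_mono) auto
  finally show ?thesis .
qed

theorem corollary3p1:
  fixes D :: "'a pair_pre_digraph" and n :: nat
  assumes "oriented_graph D"
    and "card (pverts D) = n"
    and "anti_transitive 7 D"
    and "real (min_out_degree D) \<ge> real n / 3"
    and "real (min_in_degree D) \<ge> real n / 3"
  shows "\<exists>x \<in> pverts D. \<exists>y \<in> pverts D. \<exists>z \<in> pverts D.
    (x, y) \<in> parcs D \<and> (y, z) \<in> parcs D \<and> (z, x) \<in> parcs D"
proof (rule ccontr)
  assume neg: "\<not> ?thesis"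
  interpret oriented_graph D by fact
  define E where "E x y \<longleftrightarrow> (x, y) \<in> parcs D" for x y
  have E_verts: "x \<in> pverts D" "y \<in> pverts D" if "E x y" for x y
    using that in_arcsD1 in_arcsD2 unfolding E_def by auto
  have asym: "\<not> E y x" if "E x y" for x y
    using that no_opposite_arcs unfolding E_def by blast
  have no_triangle: "\<not> E z x" if "E x y" "E y z" for x y z
    using that neg E_verts[OF that(1)] E_verts[OF that(2)] unfolding E_def by blast
  have out_card: "n \<le> 3 * card {w. E v w}" if "v \<in> pverts D" for v
  proof -
    have "min_out_degree D \<le> out_degree (with_proj D) v"
      unfolding min_out_degree_def using that by (intro Min_le) auto
    with assms(4) show ?thesis by (simp add: out_degree_eq_card E_def)
  qed
  have in_card: "n \<le> 3 * card {u. E u v}" if "v \<in> pverts D" for v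
  proof -
    have "min_in_degree D \<le> in_degree (with_proj D) v"
      unfolding min_in_degree_def using that by (intro Min_le) auto
    with assms(5) show ?thesis by (simp add: in_degree_eq_card E_def)
  qed

  have out_ext: "\<exists>x. E v x \<and> E w x" if vw: "E v w" for v w
  proof (rule ccontr)
    assume none: "\<not> ?thesis"
    \<comment> \<open>A common element of the first and third sets would close a triangle through
      the arc from \<open>v\<close> to \<open>w\<close>; \<open>none\<close> separates the second
      from the third.\<close>
    have "card {u. E u v} + card {x. E v x} + card {x. E w x} < card (pverts D)"
      by (rule card_three_disjoint_subsets_less[where v = v])
        (simp, (use none vw asym no_triangle E_verts in blast)+)
    then show False
      using out_card[of v] out_card[of w] in_card[of v] E_verts[OF vw] assms(2) by linarith
  qed
  have in_ext: "\<exists>x. E x v \<and> E x w" if wv: "E w v" for v w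
  proof (rule ccontr)
    assume none: "\<not> ?thesis"
    have "card {u. E v u} + card {x. E x v} + card {x. E x w} < card (pverts D)"
      by (rule card_three_disjoint_subsets_less[where v = v])
        (simp, (use none wv asym no_triangle E_verts in blast)+)
    then show False
      using out_card[of v] in_card[of w] in_card[of v] E_verts[OF wv] assms(2) by linarith
  qed

  obtain a where a: "a \<in> pverts D"
    using verts_nonempty by blast
  \<comment> \<open>Positivity of \<open>n\<close> makes the degree bound nontrivial, so
    \<open>a\<close> has an out-neighbour to start from.\<close>
  then have "n > 0"
    using assms(2) by (auto simp: card_gt_0_iff)
  with out_card[OF a] have "{w. E a w} \<noteq> {}"
    by (intro notI) simp
  then obtain b where "E a b"
    by blast
  have "\<exists>x0 x1 x2 x3 x4 x5 x6 x7. distinct [x0, x1, x2, x3, x4, x5, x6, x7] \<and>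
      E x0 x1 \<and> E x1 x2 \<and> E x2 x3 \<and> E x3 x4 \<and> E x4 x5 \<and> E x5 x6 \<and> E x6 x7 \<and> E x0 x7"
    by (rule bypass_of_length_7) (fact \<open>E a b\<close> asym no_triangle out_ext in_ext)+
  then obtain x0 x1 x2 x3 x4 x5 x6 x7 where
    dist: "distinct [x0, x1, x2, x3, x4, x5, x6, x7]"
    and path: "E x0 x1" "E x1 x2" "E x2 x3" "E x3 x4" "E x4 x5" "E x5 x6" "E x6 x7"
    and arc: "E x0 x7"
    by blast
  let ?p = "[(x0, x1), (x1, x2), (x2, x3), (x3, x4), (x4, x5), (x5, x6), (x6, x7)]"
  have "apath x0 ?p x7"
    using dist path E_verts[OF arc] by (simp add: apath_def awalk_def E_def)
  moreover have "length ?p = 7"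
    by simp
  ultimately have "(x0, x7) \<notin> parcs D"
    using assms(3) E_verts[OF arc] unfolding anti_transitive_def by blast
  with arc show False
    by (simp add: E_def)
qed

end
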